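(* Let $S_1,S_2,\dots,S_n$ be any subsets of $\mathbb{R}^m$, and let $k\ge 0$ be an integer. Assume $z$ is a $k$-extreme point of the convex set $\operatorname{conv}\sum_{i=1}^n S_i$. Then there exist integers $k_1,\dots,k_n$ with $1\le k_i\le k+1$ for all $i$ and $\sum_{i=1}^n k_i\le k+n$, and points $z^i\in\operatorname{conv}_{k_i}S_i$ ($i=1,\dots,n$), such that $z=\sum_{i=1}^n z^i$.
   Context: $\sum_{i=1}^n S_i=\{s^1+\dots+s^n : s^i\in S_i\}$ is the Minkowski sum and $\operatorname{conv}$ denotes the convex hull. For an integer $k\ge 1$, the $k$th convex hull of a set $S\subseteq\mathbb{R}^m$ is the set of convex combinations of $k$ points of $S$: $$\operatorname{conv}_k S=\Big\{\sum_{j=1}^k\alpha_j v^j : v^j\in S,\ \alpha_j\ge 0\ (j=1,\dots,k),\ \sum_{j=1}^k\alpha_j=1\Big\}.$$ A point $z$ of a convex set $S\subseteq\mathbb{R}^m$ is called a $k$-extreme point of $S$ if there do not exist $k+1$ linearly independent vectors $d^1,\dots,d^{k+1}\in\mathbb{R}^m$ such that $z+d^i\in S$ and $z-d^i\in S$ for all $i=1,\dots,k+1$. *)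

theory Defs
  imports "HOL-Analysis.Analysis"
begin

(* The points v j need not be distinct. For k = 0 the set is empty. *)
definition conv_k :: "nat \<Rightarrow> 'a::real_vector set \<Rightarrow> 'a set" where
  "conv_k k S = {\<Sum>j=1..k. \<alpha> j *\<^sub>R v j |(\<alpha>::nat \<Rightarrow> real) (v::nat \<Rightarrow> 'a).
     (\<forall>j\<in>{1..k}. v j \<in> S \<and> 0 \<le> \<alpha> j) \<and> (\<Sum>j=1..k. \<alpha> j) = 1}"

(* Injectivity is needed: "independent" speaks about the set of the d i, and a repeated
   vector would otherwise go unnoticed. *)
definition k_extreme_point :: "nat \<Rightarrow> 'a::real_vector \<Rightarrow> 'a set \<Rightarrow> bool" where
  "k_extreme_point k z S \<longleftrightarrow> convex S \<and> z \<in> S \<and>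
     \<not> (\<exists>d::nat \<Rightarrow> 'a. inj_on d {1..k+1} \<and> independent (d ` {1..k+1}) \<and>
          (\<forall>i\<in>{1..k+1}. z + d i \<in> S \<and> z - d i \<in> S))"

end

theory Submission
  imports Defs
begin

text \<open>
  Write \<open>z = \<Sum>\<^sub>i \<Sum>\<^sub>v \<alpha>(i,v) v\<close> with \<open>v\<close> ranging over finite subsets of the \<open>S\<^sub>i\<close> and with
  as few terms as possible; then all weights are positive. Choose one base point \<open>b\<^sub>i\<close> for each
  \<open>i\<close>. By minimality the differences \<open>v - b\<^sub>i\<close> of the remaining terms are linearly independent:
  a linear relation among them would allow the weights to be shifted until one of them vanishes.
  Since \<open>z\<close> plus or minus a small multiple of such a difference stays in the hull of the Minkowski
  sum, \<open>k\<close>-extremality leaves at most \<open>k\<close> differences, hence at most \<open>k + n\<close> terms.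
\<close>

section \<open>Weighted representations of points in the hull of a Minkowski sum\<close>

text \<open>Pairs \<open>(i, v)\<close> tag each point with its summand, so that a point lying in
  several of the sets is counted and weighted separately for each of them.\<close>

definition minkowski_comb ::
    "'i set \<Rightarrow> ('i \<Rightarrow> 'a::real_vector set) \<Rightarrow> 'a \<Rightarrow> ('i \<times> 'a) set \<Rightarrow> ('i \<times> 'a \<Rightarrow> real) \<Rightarrow> bool" where
  "minkowski_comb I S z P \<alpha> \<longleftrightarrow> finite P \<and> P \<subseteq> Sigma I S \<and> (\<forall>p\<in>P. 0 \<le> \<alpha> p) \<and>
     (\<forall>i\<in>I. sum \<alpha> {p\<in>P. fst p = i} = 1) \<and> (\<Sum>p\<in>P. \<alpha> p *\<^sub>R snd p) = z"

text \<open>The hull of a Minkowski sum is the Minkowski sum of the hulls, and the terms over each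
  index form a convex combination in the hull of that summand.\<close>

lemma minkowski_comb_in_hull:
  assumes "finite I" and comb: "minkowski_comb I S z P \<alpha>"
  shows "z \<in> convex hull (\<Sum>i\<in>I. S i)"
proof -
  have P: "finite P" "P \<subseteq> Sigma I S" and nonneg: "\<And>p. p \<in> P \<Longrightarrow> 0 \<le> \<alpha> p"
    and one: "\<And>i. i \<in> I \<Longrightarrow> sum \<alpha> {p\<in>P. fst p = i} = 1"
    and z: "(\<Sum>p\<in>P. \<alpha> p *\<^sub>R snd p) = z"
    using comb by (auto simp: minkowski_comb_def)
  let ?s = "\<lambda>i. \<Sum>p\<in>{p\<in>P. fst p = i}. \<alpha> p *\<^sub>R snd p"
  have "?s i \<in> convex hull S i" if "i \<in> I" for i
  proof (rule convex_sum)
    show "snd p \<in> convex hull S i" if "p \<in> {p\<in>P. fst p = i}" for p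
      using that P by (intro hull_inc) auto
  qed (use that P one nonneg in auto)
  moreover have "z = sum ?s I"
    unfolding z[symmetric] using P \<open>finite I\<close> by (intro sum.group[symmetric]) auto
  ultimately show ?thesis
    unfolding convex_hull_set_sum set_sum_alt[OF \<open>finite I\<close>, of "\<lambda>i. convex hull S i"] by blast
qed

lemma hull_minkowski_comb:
  assumes "finite I" and "z \<in> convex hull (\<Sum>i\<in>I. S i)"
  shows "\<exists>P \<alpha>. minkowski_comb I S z P \<alpha>"
proof -
  obtain s where z: "z = sum s I" and s: "\<And>i. i \<in> I \<Longrightarrow> s i \<in> convex hull S i"
    using assms unfolding convex_hull_set_sum set_sum_alt[OF \<open>finite I\<close>, of "\<lambda>i. convex hull S i"] by blast
  have "\<forall>i\<in>I. \<exists>F u. finite F \<and> F \<subseteq> S i \<and> (\<forall>x\<in>F. 0 \<le> u x) \<and> sum u F = 1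
      \<and> (\<Sum>v\<in>F. u v *\<^sub>R v) = s i"
    using s unfolding convex_hull_explicit by blast
  then obtain F u where F: "\<And>i. i \<in> I \<Longrightarrow> finite (F i) \<and> F i \<subseteq> S i \<and> (\<forall>x\<in>F i. 0 \<le> u i x)
      \<and> sum (u i) (F i) = 1 \<and> (\<Sum>v\<in>F i. u i v *\<^sub>R v) = s i"
    unfolding bchoice_iff by blast
  let ?P = "Sigma I F" and ?\<alpha> = "\<lambda>p. u (fst p) (snd p)"
  have "sum ?\<alpha> {p\<in>?P. fst p = i} = 1" if "i \<in> I" for i
  proof -
    have "{p\<in>?P. fst p = i} = Pair i ` F i"
      using that by auto
    then show ?thesis
      using F[OF that] by (simp add: sum.reindex inj_on_def)
  qed
  moreover have "(\<Sum>p\<in>?P. ?\<alpha> p *\<^sub>R snd p) = z"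
  proof -
    have "(\<Sum>p\<in>?P. ?\<alpha> p *\<^sub>R snd p) = (\<Sum>i\<in>I. \<Sum>v\<in>F i. u i v *\<^sub>R v)"
      using F \<open>finite I\<close> by (subst sum.Sigma) (auto simp: case_prod_beta)
    then show ?thesis
      using F z by simp
  qed
  ultimately have "minkowski_comb I S z ?P ?\<alpha>"
    unfolding minkowski_comb_def using F \<open>finite I\<close> by auto
  then show ?thesis by blast
qed

section \<open>Shifting weights between the terms of a representation\<close>

lemma minkowski_comb_remove:
  assumes comb: "minkowski_comb I S z P \<alpha>" and "\<alpha> q = 0"
  shows "minkowski_comb I S z (P - {q}) \<alpha>"
proof -
  have "finite P"
    using comb by (simp add: minkowski_comb_def)
  have "sum \<alpha> {p \<in> P - {q}. fst p = i} = sum \<alpha> {p \<in> P. fst p = i}" for i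
    using \<open>finite P\<close> \<open>\<alpha> q = 0\<close> by (intro sum.mono_neutral_left) auto
  moreover have "(\<Sum>p\<in>P - {q}. \<alpha> p *\<^sub>R snd p) = (\<Sum>p\<in>P. \<alpha> p *\<^sub>R snd p)"
    using \<open>finite P\<close> \<open>\<alpha> q = 0\<close> by (intro sum.mono_neutral_left) auto
  ultimately show ?thesis
    using comb by (auto simp: minkowski_comb_def)
qed

lemma minkowski_comb_perturb:
  assumes "minkowski_comb I S z P \<alpha>"
    and "\<And>i. i \<in> I \<Longrightarrow> sum \<delta> {p\<in>P. fst p = i} = 0"
    and "\<And>p. p \<in> P \<Longrightarrow> 0 \<le> \<alpha> p + \<delta> p"
  shows "minkowski_comb I S (z + (\<Sum>p\<in>P. \<delta> p *\<^sub>R snd p)) P (\<lambda>p. \<alpha> p + \<delta> p)"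
  using assms by (auto simp: minkowski_comb_def sum.distrib scaleR_add_left)

text \<open>This is the reduction step of Caratheodory's theorem. Adding a multiple of \<gamma>
  changes neither the fibre sums nor the represented point, so one can go on until the first weight
  reaches zero and drop that pair.\<close>

lemma minkowski_comb_eliminate:
  assumes comb: "minkowski_comb I S z P \<alpha>"
    and fibre: "\<And>i. i \<in> I \<Longrightarrow> sum \<gamma> {p\<in>P. fst p = i} = 0"
    and rel: "(\<Sum>p\<in>P. \<gamma> p *\<^sub>R snd p) = 0"
    and "\<exists>p\<in>P. \<gamma> p < 0"
  shows "\<exists>q\<in>P. \<exists>\<beta>. minkowski_comb I S z (P - {q}) \<beta>"
proof -
  have "finite P" and nonneg: "\<And>p. p \<in> P \<Longrightarrow> 0 \<le> \<alpha> p"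
    using comb by (auto simp: minkowski_comb_def)
  let ?N = "{p\<in>P. \<gamma> p < 0}"
  have "finite ?N" "?N \<noteq> {}"
    using assms \<open>finite P\<close> by auto
  from ex_is_arg_min_if_finite[OF this, of "\<lambda>p. \<alpha> p / - \<gamma> p"]
  obtain q where q: "q \<in> P" "\<gamma> q < 0"
    and min: "\<And>p. p \<in> P \<Longrightarrow> \<gamma> p < 0 \<Longrightarrow> \<alpha> q / - \<gamma> q \<le> \<alpha> p / - \<gamma> p"
    by (auto simp: is_arg_min_linorder)
  \<comment> \<open>The largest admissible step: weights with \<gamma> nonnegative never decrease,
    and among the others \<open>q\<close> is one that reaches zero first.\<close>
  define t where "t = \<alpha> q / - \<gamma> q"
  have "0 \<le> t"
    using q nonneg by (simp add: t_def divide_nonneg_neg)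
  have "0 \<le> \<alpha> p + t * \<gamma> p" if "p \<in> P" for p
  proof (cases "\<gamma> p < 0")
    case True
    then have "t * - \<gamma> p \<le> \<alpha> p"
      using min[OF that True] by (subst (asm) pos_le_divide_eq) (auto simp: t_def)
    then show ?thesis by simp
  next
    case False
    then show ?thesis
      using \<open>0 \<le> t\<close> nonneg[OF that] by simp
  qed
  then have "minkowski_comb I S (z + (\<Sum>p\<in>P. (t * \<gamma> p) *\<^sub>R snd p)) P (\<lambda>p. \<alpha> p + t * \<gamma> p)"
    using comb fibre by (intro minkowski_comb_perturb) (auto simp flip: sum_distrib_left)
  moreover have "(\<Sum>p\<in>P. (t * \<gamma> p) *\<^sub>R snd p) = 0"
    using rel by (simp flip: scaleR_scaleR scaleR_right.sum)
  moreover have "\<alpha> q + t * \<gamma> q = 0"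
    using q by (simp add: t_def)
  ultimately show ?thesis
    using minkowski_comb_remove[of I S z P "\<lambda>p. \<alpha> p + t * \<gamma> p" q] q by auto
qed

text \<open>Extends weights on \<open>Q\<close> to the base points so that every fibre has total weight zero.\<close>

definition balance :: "('i \<times> 'a) set \<Rightarrow> ('i \<times> 'a \<Rightarrow> real) \<Rightarrow> 'i \<times> 'a \<Rightarrow> real" where
  "balance Q \<beta> p = (if p \<in> Q then \<beta> p else - sum \<beta> {q\<in>Q. fst q = fst p})"

text \<open>Over each index the base point is the only pair outside \<open>Q\<close>. Its weight
  cancels the others, which subtracts their total multiple of \<open>b i\<close> from the weighted
  sum.\<close>

lemma balance_fibre_sums:
  fixes b :: "'i \<Rightarrow> 'a::real_vector"
  assumes "finite Q" and "\<And>i. i \<in> I \<Longrightarrow> (i, b i) \<notin> Q" and "i \<in> I"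
    and P: "P = Q \<union> (\<lambda>i. (i, b i)) ` I"
  shows "sum (balance Q \<beta>) {p\<in>P. fst p = i} = 0"
    and "(\<Sum>p\<in>{p\<in>P. fst p = i}. balance Q \<beta> p *\<^sub>R snd p) =
         (\<Sum>q\<in>{q\<in>Q. fst q = i}. \<beta> q *\<^sub>R (snd q - b (fst q)))"
proof -
  let ?Q = "{q\<in>Q. fst q = i}"
  have fib: "{p\<in>P. fst p = i} = insert (i, b i) ?Q"
    using assms by auto
  have base: "balance Q \<beta> (i, b i) = - sum \<beta> ?Q" "(i, b i) \<notin> ?Q" "finite ?Q"
    using assms by (auto simp: balance_def)
  show "sum (balance Q \<beta>) {p\<in>P. fst p = i} = 0"
    unfolding fib using base by (simp add: balance_def)
  have "(\<Sum>p\<in>{p\<in>P. fst p = i}. balance Q \<beta> p *\<^sub>R snd p)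
      = (\<Sum>q\<in>?Q. \<beta> q *\<^sub>R snd q) - sum \<beta> ?Q *\<^sub>R b i"
    unfolding fib using base by (simp add: balance_def)
  also have "\<dots> = (\<Sum>q\<in>?Q. \<beta> q *\<^sub>R (snd q - b (fst q)))"
    by (simp add: scaleR_diff_right sum_subtractf scaleR_left.sum)
  finally show "(\<Sum>p\<in>{p\<in>P. fst p = i}. balance Q \<beta> p *\<^sub>R snd p) = \<dots>" .
qed

text \<open>Translates between differences and weights: a linear combination of differences is the
  displacement caused by a balanced change of weights. This serves both to eliminate a term and to
  move the represented point.\<close>

lemma balance_sum:
  fixes b :: "'i \<Rightarrow> 'a::real_vector"
  assumes "finite I" "finite Q" "fst ` Q \<subseteq> I" and base: "\<And>i. i \<in> I \<Longrightarrow> (i, b i) \<notin> Q"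
    and P: "P = Q \<union> (\<lambda>i. (i, b i)) ` I"
  shows "(\<Sum>p\<in>P. balance Q \<beta> p *\<^sub>R snd p) = (\<Sum>q\<in>Q. \<beta> q *\<^sub>R (snd q - b (fst q)))"
proof -
  have "(\<Sum>p\<in>P. balance Q \<beta> p *\<^sub>R snd p)
      = (\<Sum>i\<in>I. \<Sum>p\<in>{p\<in>P. fst p = i}. balance Q \<beta> p *\<^sub>R snd p)"
    using assms by (intro sum.group[symmetric]) auto
  also have "\<dots> = (\<Sum>i\<in>I. \<Sum>q\<in>{q\<in>Q. fst q = i}. \<beta> q *\<^sub>R (snd q - b (fst q)))"
    by (intro sum.cong refl balance_fibre_sums(2)[OF \<open>finite Q\<close> base _ P])
  also have "\<dots> = (\<Sum>q\<in>Q. \<beta> q *\<^sub>R (snd q - b (fst q)))"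
    using assms by (intro sum.group) auto
  finally show ?thesis .
qed

section \<open>Independence of the differences, and room to move along them\<close>

text \<open>Working with coefficients on indices also excludes repeated values: if
  \<open>f x = f y\<close> with \<open>x\<close> and \<open>y\<close> distinct, the coefficients 1
  and -1 would give a nontrivial relation.\<close>

lemma inj_on_independent_imageI:
  fixes f :: "'b \<Rightarrow> 'a::real_vector"
  assumes "finite Q" and indep: "\<And>\<beta>. (\<Sum>q\<in>Q. \<beta> q *\<^sub>R f q) = 0 \<Longrightarrow> \<forall>q\<in>Q. \<beta> q = 0"
  shows "inj_on f Q \<and> independent (f ` Q)"
proof
  show inj: "inj_on f Q"
  proof (rule inj_onI, rule ccontr)
    fix x y
    assume xy: "x \<in> Q" "y \<in> Q" "f x = f y" "x \<noteq> y"
    let ?\<beta> = "\<lambda>q. if q = x then 1 else if q = y then - 1 else 0 :: real"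
    have "(\<Sum>q\<in>Q. ?\<beta> q *\<^sub>R f q) = (\<Sum>q\<in>{x, y}. ?\<beta> q *\<^sub>R f q)"
      using xy \<open>finite Q\<close> by (intro sum.mono_neutral_right) auto
    also have "\<dots> = 0"
      using xy by simp
    finally have "?\<beta> x = 0"
      using indep[of ?\<beta>] xy(1) by blast
    then show False by simp
  qed
  show "independent (f ` Q)"
  proof
    assume "dependent (f ` Q)"
    then obtain u where "\<exists>v\<in>f ` Q. u v \<noteq> 0" "(\<Sum>v\<in>f ` Q. u v *\<^sub>R v) = 0"
      using \<open>finite Q\<close> by (auto simp: dependent_finite)
    then show False
      using indep[of "u \<circ> f"] inj by (auto simp: sum.reindex)
  qed
qed

text \<open>A nonzero balanced weight change sums to zero over each fibre, so it has a negative
  entry. If it also fixed the represented point, \<open>minkowski_comb_eliminate\<close> would yield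
  a smaller representation.\<close>

lemma minkowski_comb_minimal_independent:
  fixes b :: "'i \<Rightarrow> 'a::real_vector"
  assumes comb: "minkowski_comb I S z P \<alpha>"
    and minimal: "\<And>P' \<beta>. minkowski_comb I S z P' \<beta> \<Longrightarrow> card P \<le> card P'"
    and "finite I" and Q: "fst ` Q \<subseteq> I" "\<And>i. i \<in> I \<Longrightarrow> (i, b i) \<notin> Q"
    and P: "P = Q \<union> (\<lambda>i. (i, b i)) ` I"
  shows "inj_on (\<lambda>q. snd q - b (fst q)) Q \<and> independent ((\<lambda>q. snd q - b (fst q)) ` Q)"
proof (rule inj_on_independent_imageI)
  have "finite P"
    using comb by (simp add: minkowski_comb_def)
  then show finQ: "finite Q"
    using P by simp
  fix \<beta> :: "'i \<times> 'a \<Rightarrow> real"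
  assume rel: "(\<Sum>q\<in>Q. \<beta> q *\<^sub>R (snd q - b (fst q))) = 0"
  let ?\<gamma> = "balance Q \<beta>"
  note fibre = balance_fibre_sums(1)[OF finQ Q(2) _ P, of _ \<beta>]
  have nonneg: "\<forall>p\<in>P. 0 \<le> ?\<gamma> p"
  proof (rule ccontr)
    assume "\<not> ?thesis"
    then have "\<exists>p\<in>P. ?\<gamma> p < 0"
      by force
    then obtain q \<beta>' where "q \<in> P" "minkowski_comb I S z (P - {q}) \<beta>'"
      using minkowski_comb_eliminate[OF comb fibre] rel balance_sum[OF \<open>finite I\<close> finQ Q P, of \<beta>]
      by auto
    moreover have "card (P - {q}) < card P"
      using \<open>q \<in> P\<close> \<open>finite P\<close> by (intro card_Diff1_less)
    ultimately show False
      using minimal by fastforce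
  qed
  show "\<forall>q\<in>Q. \<beta> q = 0"
  proof
    fix q
    assume "q \<in> Q"
    then have "q \<in> P" "fst q \<in> I"
      using P Q by auto
    then have "?\<gamma> q = 0"
      using fibre[of "fst q"] nonneg \<open>finite P\<close>
        sum_nonneg_eq_0_iff[of "{p\<in>P. fst p = fst q}" ?\<gamma>] by (cases q) auto
    then show "\<beta> q = 0"
      using \<open>q \<in> Q\<close> by (simp add: balance_def)
  qed
qed

text \<open>Transferring weight \<open>c\<close> from a base point to \<open>q\<close> moves
  \<open>z\<close> along the difference. The bound on the absolute value of \<open>c\<close> admits
  both signs, hence both directions.\<close>

lemma minkowski_comb_move:
  fixes b :: "'i \<Rightarrow> 'a::real_vector"
  assumes comb: "minkowski_comb I S z P \<alpha>" and "finite I"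
    and Q: "fst ` Q \<subseteq> I" "\<And>i. i \<in> I \<Longrightarrow> (i, b i) \<notin> Q"
    and P: "P = Q \<union> (\<lambda>i. (i, b i)) ` I"
    and c: "\<And>p. p \<in> P \<Longrightarrow> \<bar>c\<bar> \<le> \<alpha> p" and "q \<in> Q"
  shows "z + c *\<^sub>R (snd q - b (fst q)) \<in> convex hull (\<Sum>i\<in>I. S i)"
proof -
  have finQ: "finite Q"
    using comb P by (simp add: minkowski_comb_def)
  \<comment> \<open>After balancing, the only weights in \<open>P\<close> that change are those of
    \<open>q\<close>, by \<open>c\<close>, and of the base point over the same index, by
    \<open>-c\<close>.\<close>
  let ?\<beta> = "\<lambda>p. if p = q then c else 0"
  have "\<bar>balance Q ?\<beta> p\<bar> \<le> \<bar>c\<bar>" for p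
    using finQ by (simp add: balance_def sum.delta)
  then have "0 \<le> \<alpha> p + balance Q ?\<beta> p" if "p \<in> P" for p
    using c[OF that] by (smt (verit))
  then have "minkowski_comb I S (z + (\<Sum>p\<in>P. balance Q ?\<beta> p *\<^sub>R snd p)) P (\<lambda>p. \<alpha> p + balance Q ?\<beta> p)"
    using comb balance_fibre_sums(1)[OF finQ Q(2) _ P, of _ ?\<beta>]
    by (intro minkowski_comb_perturb) auto
  moreover have "(\<Sum>p\<in>P. balance Q ?\<beta> p *\<^sub>R snd p) = c *\<^sub>R (snd q - b (fst q))"
    using balance_sum[OF \<open>finite I\<close> finQ Q P, of ?\<beta>] finQ \<open>q \<in> Q\<close>
    by (simp add: if_distrib[of "\<lambda>c. c *\<^sub>R _"] cong: if_cong)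
  ultimately show ?thesis
    using minkowski_comb_in_hull[OF \<open>finite I\<close>] by metis
qed

section \<open>Bounding the number of terms by extremality\<close>

lemma k_extreme_minkowski_comb:
  fixes S :: "'i \<Rightarrow> 'a::real_vector set"
  assumes "finite I" and ext: "k_extreme_point k z (convex hull (\<Sum>i\<in>I. S i))"
  shows "\<exists>P \<alpha>. minkowski_comb I S z P \<alpha> \<and> card P \<le> k + card I"
proof -
  have "z \<in> convex hull (\<Sum>i\<in>I. S i)"
    using ext by (simp add: k_extreme_point_def)
  then have "\<exists>P. \<exists>\<alpha>. minkowski_comb I S z P \<alpha>"
    using hull_minkowski_comb[OF \<open>finite I\<close>] by blast
  then obtain P where "\<exists>\<alpha>. minkowski_comb I S z P \<alpha>"
    and minimal: "\<And>P' \<beta>. minkowski_comb I S z P' \<beta> \<Longrightarrow> card P \<le> card P'"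
    using exists_least_iff[of "\<lambda>m. \<exists>P \<alpha>. card P = m \<and> minkowski_comb I S z P \<alpha>"]
    by (metis linorder_le_less_linear)
  then obtain \<alpha> where comb: "minkowski_comb I S z P \<alpha>"
    by blast
  have "finite P" "P \<subseteq> Sigma I S" and nonneg: "\<And>p. p \<in> P \<Longrightarrow> 0 \<le> \<alpha> p"
    and one: "\<And>i. i \<in> I \<Longrightarrow> sum \<alpha> {p\<in>P. fst p = i} = 1"
    using comb by (auto simp: minkowski_comb_def)
  have pos: "0 < \<alpha> p" if "p \<in> P" for p
  proof (rule ccontr)
    assume "\<not> 0 < \<alpha> p"
    then have "minkowski_comb I S z (P - {p}) \<alpha>"
      using nonneg[OF that] by (intro minkowski_comb_remove[OF comb]) simp
    moreover have "card (P - {p}) < card P"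
      using that \<open>finite P\<close> by (intro card_Diff1_less)
    ultimately show False
      using minimal by fastforce
  qed
  have "\<exists>v. (i, v) \<in> P" if "i \<in> I" for i
    using one[OF that] by (cases "{p\<in>P. fst p = i} = {}") auto
  then obtain b where b: "\<And>i. i \<in> I \<Longrightarrow> (i, b i) \<in> P"
    by metis
  let ?B = "(\<lambda>i. (i, b i)) ` I"
  define Q where "Q = P - ?B"
  have Q: "fst ` Q \<subseteq> I" "\<And>i. i \<in> I \<Longrightarrow> (i, b i) \<notin> Q" and P: "P = Q \<union> ?B"
    using \<open>P \<subseteq> Sigma I S\<close> b by (auto simp: Q_def)
  have "card ?B = card I"
    by (intro card_image) (auto simp: inj_on_def)
  have "finite Q"
    using \<open>finite P\<close> by (simp add: Q_def)
  have "card P = card Q + card ?B"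
    unfolding P using \<open>finite Q\<close> \<open>finite I\<close> Q by (intro card_Un_disjoint) auto
  then have cardP: "card P = card Q + card I"
    using \<open>card ?B = card I\<close> by simp
  \<comment> \<open>One step length must serve all differences; finiteness of \<open>P\<close>
    provides it. The set \<open>P\<close> is empty precisely when \<open>I\<close> is, and then
    \<open>Min\<close> would be undefined.\<close>
  have "\<exists>e>0. \<forall>p\<in>P. e \<le> \<alpha> p"
  proof (cases "P = {}")
    case True
    then show ?thesis by (auto intro: exI[of _ 1])
  next
    case False
    then show ?thesis
      using \<open>finite P\<close> pos by (intro exI[of _ "Min (\<alpha> ` P)"]) auto
  qed
  then obtain e where e: "0 < e" "\<And>p. p \<in> P \<Longrightarrow> e \<le> \<alpha> p"
    by blast
  let ?f = "\<lambda>q. snd q - b (fst q)"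
  have f: "inj_on ?f Q" "independent (?f ` Q)"
    using minkowski_comb_minimal_independent[OF comb minimal \<open>finite I\<close> Q P] by auto
  have "card Q \<le> k"
  proof (rule ccontr)
    assume "\<not> card Q \<le> k"
    then have "k + 1 \<le> card Q" by simp
    then obtain Q' where Q': "Q' \<subseteq> Q" "card Q' = k + 1" "finite Q'"
      using obtain_subset_with_card_n by metis
    then obtain g where g: "bij_betw g {1..k+1} Q'"
      using ex_bij_betw_nat_finite_1[of Q'] by auto
    \<comment> \<open>Scaling by \<open>e\<close> preserves independence and keeps the steps in both
      directions inside the hull, so these are the vectors forbidden by
      \<open>k_extreme_point\<close>.\<close>
    let ?d = "\<lambda>j. e *\<^sub>R ?f (g j)"
    have "inj_on ?d {1..k+1}"
    proof (rule inj_onI)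
      fix i j
      assume "i \<in> {1..k+1}" "j \<in> {1..k+1}" "?d i = ?d j"
      then have "?f (g i) = ?f (g j)" "g i \<in> Q" "g j \<in> Q"
        using g Q' e(1) by (auto simp: bij_betw_def)
      then have "g i = g j"
        by (rule inj_onD[OF f(1)])
      then show "i = j"
        using g \<open>i \<in> _\<close> \<open>j \<in> _\<close> by (auto simp: bij_betw_def dest: inj_onD)
    qed
    moreover have "independent (?d ` {1..k+1})"
    proof -
      have "independent (?f ` Q')"
        using f(2) Q' by (meson independent_mono image_mono)
      then have "independent ((\<lambda>x. e *\<^sub>R x) ` ?f ` Q')"
        using e(1) by (intro linear_independent_injective_image)
          (auto simp: inj_on_def intro: bounded_linear.linear bounded_linear_scaleR_right)
      moreover have "(\<lambda>x. e *\<^sub>R x) ` ?f ` Q' = ?d ` {1..k+1}"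
        using g by (auto simp: bij_betw_def image_image)
      ultimately show ?thesis by simp
    qed
    moreover have "z + ?d j \<in> convex hull (\<Sum>i\<in>I. S i) \<and> z - ?d j \<in> convex hull (\<Sum>i\<in>I. S i)"
      if "j \<in> {1..k+1}" for j
    proof -
      have "g j \<in> Q"
        using that g Q' by (auto simp: bij_betw_def)
      note move = minkowski_comb_move[OF comb \<open>finite I\<close> Q P _ this]
      show ?thesis
        using move[of e] move[of "- e"] e by simp
    qed
    ultimately show False
      using ext unfolding k_extreme_point_def by blast
  qed
  then show ?thesis
    using comb cardP by auto
qed

section \<open>Reading off the points of the summands\<close>

lemma conv_k_cardI:
  fixes v :: "'b \<Rightarrow> 'a::real_vector"
  assumes "finite F" and "\<And>p. p \<in> F \<Longrightarrow> v p \<in> S \<and> 0 \<le> \<alpha> p" and "sum \<alpha> F = 1"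
  shows "(\<Sum>p\<in>F. \<alpha> p *\<^sub>R v p) \<in> conv_k (card F) S"
proof -
  obtain h where h: "bij_betw h {1..card F} F"
    using ex_bij_betw_nat_finite_1[OF \<open>finite F\<close>] by blast
  have "(\<Sum>p\<in>F. \<alpha> p *\<^sub>R v p) = (\<Sum>j=1..card F. \<alpha> (h j) *\<^sub>R v (h j))"
    and "(\<Sum>j=1..card F. \<alpha> (h j)) = 1"
    using sum.reindex_bij_betw[OF h, of "\<lambda>p. \<alpha> p *\<^sub>R v p"]
      sum.reindex_bij_betw[OF h, of \<alpha>] assms(3) by simp_all
  moreover have "\<forall>j\<in>{1..card F}. v (h j) \<in> S \<and> 0 \<le> \<alpha> (h j)"
    using assms(2) h by (auto simp: bij_betw_def)
  ultimately show ?thesis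
    unfolding conv_k_def mem_Collect_eq
    by (intro exI[of _ "\<lambda>j. \<alpha> (h j)"] exI[of _ "\<lambda>j. v (h j)"]) blast
qed

theorem theorem2:
  fixes S :: "nat \<Rightarrow> (real ^ 'm) set" and n k :: nat and z :: "real ^ 'm"
  assumes "k_extreme_point k z (convex hull (\<Sum>i=1..n. S i))"
  shows "\<exists>(K :: nat \<Rightarrow> nat) (Z :: nat \<Rightarrow> real ^ 'm).
           (\<forall>i\<in>{1..n}. 1 \<le> K i \<and> K i \<le> k + 1) \<and>
           (\<Sum>i=1..n. K i) \<le> k + n \<and>
           (\<forall>i\<in>{1..n}. Z i \<in> conv_k (K i) (S i)) \<and>
           z = (\<Sum>i=1..n. Z i)"
proof -
  let ?I = "{1..n}"
  obtain P \<alpha> where comb: "minkowski_comb ?I S z P \<alpha>" and card: "card P \<le> k + n"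
    using k_extreme_minkowski_comb[OF _ assms] by auto
  have P: "finite P" "P \<subseteq> Sigma ?I S" and nonneg: "\<And>p. p \<in> P \<Longrightarrow> 0 \<le> \<alpha> p"
    and one: "\<And>i. i \<in> ?I \<Longrightarrow> sum \<alpha> {p\<in>P. fst p = i} = 1"
    and z: "(\<Sum>p\<in>P. \<alpha> p *\<^sub>R snd p) = z"
    using comb by (auto simp: minkowski_comb_def)
  have fst: "fst ` P \<subseteq> ?I"
    using P by auto
  define K where "K i = card {p\<in>P. fst p = i}" for i
  define Z where "Z i = (\<Sum>p\<in>{p\<in>P. fst p = i}. \<alpha> p *\<^sub>R snd p)" for i
  have sumK: "sum K ?I \<le> k + n"
    using sum.group[OF P(1) _ fst, of "\<lambda>_. 1::nat"] card by (simp add: K_def)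
  have K1: "1 \<le> K i" if "i \<in> ?I" for i
  proof -
    have "{p\<in>P. fst p = i} \<noteq> {}"
      using one[OF that] by (metis sum.empty zero_neq_one)
    then have "0 < K i"
      unfolding K_def using P(1) by (subst card_gt_0_iff) simp
    then show ?thesis by simp
  qed
  \<comment> \<open>Each of the other \<open>n - 1\<close> counts is at least 1, which leaves at
    most \<open>k + 1\<close> of the total \<open>k + n\<close>.\<close>
  have "K i \<le> k + 1" if "i \<in> ?I" for i
  proof -
    have "card (?I - {i}) \<le> sum K (?I - {i})"
      using sum_mono[of "?I - {i}" "\<lambda>_. 1" K] K1 by simp
    moreover have "sum K ?I = K i + sum K (?I - {i})"
      using that by (intro sum.remove) auto
    ultimately show ?thesis
      using sumK that by simp
  qed
  moreover have "Z i \<in> conv_k (K i) (S i)" if "i \<in> ?I" for i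
    unfolding Z_def K_def using P nonneg one[OF that] by (intro conv_k_cardI) auto
  moreover have "z = sum Z ?I"
    unfolding Z_def z[symmetric] using P fst by (intro sum.group[symmetric]) auto
  ultimately show ?thesis
    using K1 sumK by (intro exI[of _ K] exI[of _ Z]) blast
qed

end
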